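(* Let $V=\bigoplus_{i\in\mathbb{Z}^+}\mathbb{C}J_i$ be the vector space with basis $\{J_i\mid i\in\mathbb{Z}^+\}$, let $\mathcal{B}=\mathbb{C}[\partial]\otimes V$ be the free $\mathbb{C}[\partial]$-module over $V$ (the underlying module of the vertex Lie algebra of Block type), and let $A=S(\mathcal{B})$ be the free differential algebra over $V$, with derivation $\partial$. Define a bilinear map $V\times V\to z^{-1}A[z^{-1}]$, $(u,v)\mapsto Y_-^0(u,z)v$, by $$Y_-^0(J_i,z)J_j=(i+1)\,\partial J_{i+j}\,z^{-1}+(i+j+2)\,J_{i+j}\,z^{-2},\qquad i,j\ge0.$$ Then $Y_-^0$ uniquely extends to a vertex Poisson algebra structure on $A$; that is, there is a unique linear map $Y_-$ on $A$ making the differential algebra $(A,\partial)$ a vertex Poisson algebra $(A,Y_-,\partial)$ such that $Y_-(u,z)v=Y_-^0(u,z)v$ for all $u,v\in V$.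
   Context: $\mathbb{Z}^+$ denotes the set of nonnegative integers; all vector spaces are over $\mathbb{C}$. A differential algebra $(A,\partial)$ is a commutative associative unital algebra $A$ with a derivation $\partial$. The free differential algebra over a vector space $U$ is the symmetric algebra $S(\mathbb{C}[\partial]\otimes U)$ over the free $\mathbb{C}[\partial]$-module $\mathbb{C}[\partial]\otimes U$, with the operator $\partial$ (multiplication by $\partial$ on $\mathbb{C}[\partial]\otimes U$) uniquely extended to a derivation. A vertex Lie algebra $(A,Y_-,\partial)$ is a vector space $A$ with a linear operator $\partial$ and a linear map $Y_-(\cdot,z):A\to z^{-1}(\mathrm{End}\,A)[[z^{-1}]]$, $a\mapsto Y_-(a,z)=\sum_{n\ge0}a_{(n)}z^{-n-1}$, such that for all $a,b,c\in A$ and $m,n\in\mathbb{Z}^+$: (i) $a_{(n)}b=0$ for $n$ sufficiently large; (ii) $[\partial,Y_-(a,z)]=Y_-(\partial a,z)=\frac{d}{dz}Y_-(a,z)$, i.e. $(\partial a)_{(n)}b=-n\,a_{(n-1)}b$ and $a_{(n)}\partial b=\partial(a_{(n)}b)+n\,a_{(n-1)}b$ (terms with coefficient $n=0$ are zero); (iii) (half skew-symmetry) $Y_-(a,z)b=\mathrm{Sing}\big(e^{z\partial}Y_-(b,-z)a\big)$, where $\mathrm{Sing}$ keeps only the terms with negative powers of $z$; i.e. $a_{(n)}b=-\sum_{i\ge0}(-1)^{n+i}\frac{1}{i!}\partial^i(b_{(n+i)}a)$; (iv) (half Jacobi identity / half commutator formula) $a_{(m)}(b_{(n)}c)-b_{(n)}(a_{(m)}c)=\sum_{i=0}^m\binom{m}{i}(a_{(i)}b)_{(m+n-i)}c$.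 A vertex Poisson algebra is a differential algebra $(A,\partial)$ equipped with a vertex Lie algebra structure $(Y_-,\partial)$ (with the same $\partial$) such that $Y_-(a,z)(bc)=(Y_-(a,z)b)c+b(Y_-(a,z)c)$ for all $a,b,c\in A$, i.e. each $a_{(n)}$ is a derivation of the algebra $A$. *)

theory Defs
  imports Complex_Main "HOL-Library.Poly_Mapping"
begin

section \<open>Differential algebras, vertex Lie algebras, vertex Poisson algebras\<close>

locale differential_algebra =
  vector_space scale for scale :: "complex \<Rightarrow> 'a::comm_ring_1 \<Rightarrow> 'a" +
  fixes D :: "'a \<Rightarrow> 'a"
  assumes scale_mult_left: "scale c a * b = scale c (a * b)"
    and D_linear: "Vector_Spaces.linear scale scale D"
    and D_mult: "D (a * b) = D a * b + a * D b"

text \<open>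
  \<open>Y a n b\<close> stands for \<open>a\<^bsub>(n)\<^esub> b\<close>, the coefficient of \<open>z\<close> to the power \<open>-n-1\<close> in
  \<open>Y\<^sub>-(a,z) b\<close>; only \<open>n \<ge> 0\<close> occurs. The expression \<open>n - 1\<close> is truncated at \<open>n = 0\<close>, where its
  coefficient vanishes. The sum in the half skew-symmetry has finite support by truncation, so
  \<open>Sum_any\<close> is the ordinary sum over all \<open>i \<ge> 0\<close>.
\<close>

locale vertex_Lie_algebra =
  vector_space scale for scale :: "complex \<Rightarrow> 'a::ab_group_add \<Rightarrow> 'a" +
  fixes Y :: "'a \<Rightarrow> nat \<Rightarrow> 'a \<Rightarrow> 'a" and D :: "'a \<Rightarrow> 'a"
  assumes D_linear: "Vector_Spaces.linear scale scale D"
    and Y_linear_left: "Vector_Spaces.linear scale scale (\<lambda>a. Y a n b)"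
    and Y_linear_right: "Vector_Spaces.linear scale scale (\<lambda>b. Y a n b)"
    and truncation: "\<exists>N. \<forall>n\<ge>N. Y a n b = 0"
    and Y_D_left: "Y (D a) n b = - scale (of_nat n) (Y a (n - 1) b)"
    and Y_D_right: "Y a n (D b) = D (Y a n b) + scale (of_nat n) (Y a (n - 1) b)"
    and half_skew_symmetry:
      "Y a n b = - Sum_any (\<lambda>i. scale ((-1) ^ (n + i) / fact i) ((D ^^ i) (Y b (n + i) a)))"
    and half_commutator:
      "Y a m (Y b n c) - Y b n (Y a m c)
        = (\<Sum>i\<le>m. scale (of_nat (m choose i)) (Y (Y a i b) (m + n - i) c))"

locale vertex_Poisson_algebra =
  differential_algebra scale D + vertex_Lie_algebra scale Y D
  for scale :: "complex \<Rightarrow> 'a::comm_ring_1 \<Rightarrow> 'a"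
    and Y :: "'a \<Rightarrow> nat \<Rightarrow> 'a \<Rightarrow> 'a" and D :: "'a \<Rightarrow> 'a" +
  assumes Y_mult_right: "Y a n (b * c) = Y a n b * c + b * Y a n c"


section \<open>The free differential algebra over a vector space with a given basis\<close>

text \<open>
  Let \<open>U\<close> have a basis indexed by \<open>'i\<close>. Then \<open>\<complex>[\<partial>] \<otimes> U\<close> has the basis \<open>\<partial>\<^sup>n \<otimes> u\<^sub>i\<close>, indexed by the
  pairs \<open>(n, i)\<close>, and its symmetric algebra is the polynomial algebra in these basis elements:
  monomials are finitely supported exponent functions on the pairs, polynomials are finitely
  supported coefficient functions on monomials, and multiplication is convolution.
\<close>

type_synonym 'i dmonom = "(nat \<times> 'i) \<Rightarrow>\<^sub>0 nat"

type_synonym 'i free_diff_alg = "'i dmonom \<Rightarrow>\<^sub>0 complex"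

definition cscale :: "complex \<Rightarrow> 'i free_diff_alg \<Rightarrow> 'i free_diff_alg" where
  "cscale c p = Poly_Mapping.single 0 c * p"

definition dvar :: "nat \<Rightarrow> 'i \<Rightarrow> 'i free_diff_alg" where
  "dvar n i = Poly_Mapping.single (Poly_Mapping.single (n, i) 1) 1"

text \<open>
  The derivation extending multiplication by \<open>\<partial>\<close> on \<open>\<complex>[\<partial>] \<otimes> U\<close>: by the Leibniz rule a monomial
  is mapped to the sum, over the variables \<open>(n, i)\<close> occurring in it, of its exponent times the
  monomial in which one factor \<open>(n, i)\<close> is replaced by \<open>(n + 1, i)\<close>.
\<close>

definition dmon :: "'i dmonom \<Rightarrow> 'i free_diff_alg" where
  "dmon m = (\<Sum>(n, i)\<in>Poly_Mapping.keys m.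
      Poly_Mapping.single
        (m - Poly_Mapping.single (n, i) 1 + Poly_Mapping.single (Suc n, i) 1)
        (of_nat (Poly_Mapping.lookup m (n, i))))"

definition dpartial :: "'i free_diff_alg \<Rightarrow> 'i free_diff_alg" where
  "dpartial p = (\<Sum>m\<in>Poly_Mapping.keys p. cscale (Poly_Mapping.lookup p m) (dmon m))"

text \<open>The inclusion of \<open>U\<close>, given by coordinates, into its free differential algebra.\<close>

definition incl :: "('i \<Rightarrow>\<^sub>0 complex) \<Rightarrow> 'i free_diff_alg" where
  "incl u = (\<Sum>i\<in>Poly_Mapping.keys u. cscale (Poly_Mapping.lookup u i) (dvar 0 i))"

lemma cscale_single: "cscale c (Poly_Mapping.single m a) = Poly_Mapping.single m (c * a)"
  by (simp add: cscale_def mult_single)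

lemma vector_space_cscale: "vector_space cscale"
  by unfold_locales (simp_all add: cscale_def algebra_simps single_add mult_single flip: mult.assoc)

lemma poly_mapping_add_induct [case_names zero add single]:
  assumes "P 0"
    and "\<And>p q. P p \<Longrightarrow> P q \<Longrightarrow> P (p + q)"
    and "\<And>m c. P (Poly_Mapping.single m c)"
  shows "P (p :: 'k \<Rightarrow>\<^sub>0 'c::comm_monoid_add)"
proof (induction p rule: update_induct)
  case const
  show ?case by (rule assms)
next
  case (update f a b)
  have "Poly_Mapping.update a b f = f + Poly_Mapping.single a b"
    using update(1)
    by (intro poly_mapping_eqI) (auto simp: lookup_add lookup_update lookup_single in_keys_iff when_def)
  then show ?case using assms update by simp
qed

lemma dmonom_induct [case_names zero plus]:
  assumes "P 0"
    and "\<And>m v. P m \<Longrightarrow> P (m + Poly_Mapping.single v 1)"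
  shows "P (m :: 'k \<Rightarrow>\<^sub>0 nat)"
proof -
  have "P (p + Poly_Mapping.single v k)" if "P p" for p v k
  proof (induction k)
    case (Suc k)
    have "p + Poly_Mapping.single v (Suc k) = (p + Poly_Mapping.single v k) + Poly_Mapping.single v 1"
      by (simp add: add.assoc flip: single_add)
    with Suc assms(2) show ?case by metis
  qed (use that in simp)
  then have "P (p + m)" if "P p" for p
    using that
  proof (induction m arbitrary: p rule: poly_mapping_add_induct)
    case (add q r)
    then show ?case by (metis add.assoc)
  qed simp_all
  from this[OF assms(1)] show ?thesis by simp
qed

lemma sum_keys_add:
  assumes "vector_space sc"
  shows "(\<Sum>m\<in>Poly_Mapping.keys (p + q). sc (Poly_Mapping.lookup (p + q) m) (g m))
    = (\<Sum>m\<in>Poly_Mapping.keys p. sc (Poly_Mapping.lookup p m) (g m))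
      + (\<Sum>m\<in>Poly_Mapping.keys q. sc (Poly_Mapping.lookup q m) (g m))"
proof -
  interpret vector_space sc by fact
  show ?thesis
    by (rule setsum_keys_plus_distrib) (simp_all add: scale_left_distrib)
qed

lemma linear_sum_keys:
  fixes g :: "'i dmonom \<Rightarrow> 'b::ab_group_add"
  assumes "vector_space sc"
  shows "Vector_Spaces.linear cscale sc
    (\<lambda>p. \<Sum>m\<in>Poly_Mapping.keys p. sc (Poly_Mapping.lookup p m) (g m))" (is "Vector_Spaces.linear _ _ ?F")
proof -
  interpret A: vector_space "cscale :: complex \<Rightarrow> 'i free_diff_alg \<Rightarrow> _" by (rule vector_space_cscale)
  interpret vector_space sc by fact
  have add: "?F (p + q) = ?F p + ?F q" for p q
    by (rule sum_keys_add) fact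
  have "?F (cscale c p) = sc c (?F p)" for c p
  proof (induction p rule: poly_mapping_add_induct)
    case (add p q)
    then show ?case
      by (simp only: A.scale_right_distrib \<open>\<And>p q. ?F (p + q) = ?F p + ?F q\<close> scale_right_distrib)
  qed (simp_all add: cscale_single)
  with add show ?thesis
    by unfold_locales
qed

lemma linear_dpartial: "Vector_Spaces.linear cscale cscale dpartial"
  using linear_sum_keys[OF vector_space_cscale, of dmon] by (simp add: dpartial_def [abs_def])

lemma dpartial_single: "dpartial (Poly_Mapping.single m c) = cscale c (dmon m)"
  by (simp add: dpartial_def cscale_def)

lemma dmon_superset:
  assumes "finite S" "Poly_Mapping.keys m \<subseteq> S"
  shows "dmon m = (\<Sum>(n, i)\<in>S. Poly_Mapping.single
        (m - Poly_Mapping.single (n, i) 1 + Poly_Mapping.single (Suc n, i) 1)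
        (of_nat (Poly_Mapping.lookup m (n, i))))"
  unfolding dmon_def using assms
  by (intro sum.mono_neutral_left) (auto simp: in_keys_iff)

lemma dmonom_diff_add:
  fixes m m' :: "'k \<Rightarrow>\<^sub>0 nat"
  assumes "Poly_Mapping.lookup m v \<noteq> 0"
  shows "m + m' - Poly_Mapping.single v 1 = m - Poly_Mapping.single v 1 + m'"
  using assms
  by (intro poly_mapping_eqI) (auto simp: lookup_add lookup_minus lookup_single when_def)

lemma dmon_add:
  "dmon (m + m') = dmon m * Poly_Mapping.single m' 1 + Poly_Mapping.single m 1 * dmon m'"
proof -
  define S where "S = Poly_Mapping.keys m \<union> Poly_Mapping.keys m'"
  have S: "finite S" "Poly_Mapping.keys m \<subseteq> S" "Poly_Mapping.keys m' \<subseteq> S"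
    "Poly_Mapping.keys (m + m') \<subseteq> S"
    using keys_add[of m m'] by (auto simp: S_def)
  let ?e = "\<lambda>v. Poly_Mapping.single v (1::nat)"
  let ?T = "\<lambda>m n i. Poly_Mapping.single (m - ?e (n, i) + ?e (Suc n, i))
        (of_nat (Poly_Mapping.lookup m (n, i)) :: complex)"
  have 1: "Poly_Mapping.single (m + m' - ?e (n, i) + ?e (Suc n, i))
        (of_nat (Poly_Mapping.lookup m (n, i)) :: complex) = ?T m n i * Poly_Mapping.single m' 1" for m m' n i
  proof (cases "Poly_Mapping.lookup m (n, i) = 0")
    case False
    show ?thesis
      unfolding dmonom_diff_add[OF False] mult_single by (simp add: add_ac)
  qed simp
  have "?T (m + m') n i = ?T m n i * Poly_Mapping.single m' 1 + Poly_Mapping.single m 1 * ?T m' n i" for n i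
    using 1[of m m' n i] 1[of m' m n i]
    by (simp add: lookup_add single_add add.commute[of m' m] mult.commute)
  then show ?thesis
    unfolding dmon_superset[OF S(1,2)] dmon_superset[OF S(1,3)] dmon_superset[OF S(1,4)]
    by (simp add: sum_distrib_left sum_distrib_right case_prod_unfold flip: sum.distrib)
qed

lemma dpartial_mult: "dpartial (p * q) = dpartial p * q + p * dpartial q"
proof -
  interpret D: Vector_Spaces.linear cscale cscale "dpartial :: 'a free_diff_alg \<Rightarrow> _"
    by (rule linear_dpartial)
  have monomials: "dpartial (Poly_Mapping.single m c * Poly_Mapping.single m' c')
      = dpartial (Poly_Mapping.single m c) * Poly_Mapping.single m' c'
        + Poly_Mapping.single m c * dpartial (Poly_Mapping.single m' c')"
    for m m' :: "'a dmonom" and c c'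
  proof -
    have s: "Poly_Mapping.single m c = Poly_Mapping.single 0 c * Poly_Mapping.single m 1"
      for m :: "'a dmonom" and c :: complex by (simp add: mult_single)
    have c: "Poly_Mapping.single (0 :: 'a dmonom) (c * c') = Poly_Mapping.single 0 c * Poly_Mapping.single 0 c'"
      by (simp add: mult_single)
    show ?thesis
      unfolding mult_single unfolding dpartial_single cscale_def dmon_add c
      by (subst s[of m c], subst s[of m' c'], simp only: algebra_simps)
  qed
  show ?thesis
  proof (induction p rule: poly_mapping_add_induct)
    case (add p p')
    then show ?case by (simp add: D.add algebra_simps)
  next
    case (single m c)
    show ?case
      by (induction q rule: poly_mapping_add_induct) (simp_all add: monomials D.add distrib_left)
  qed simp
qed

lemma differential_algebra_free: "differential_algebra cscale dpartial"
  by (intro differential_algebra.intro differential_algebra_axioms.intro vector_space_cscale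
      linear_dpartial dpartial_mult) (simp add: cscale_def mult.assoc)

lemma dpartial_dvar: "dpartial (dvar n i) = dvar (Suc n) i"
  by (simp add: dvar_def dpartial_single dmon_def cscale_def)

lemma funpow_dpartial_dvar: "(dpartial ^^ n) (dvar 0 i) = dvar n i"
  by (induction n) (simp_all add: dpartial_dvar)

text \<open>
  The universal property that characterises the free differential algebra over \<open>U\<close>; a linear map
  out of \<open>U\<close> amounts to an arbitrary choice of the images \<open>f i\<close> of the basis vectors.
\<close>

theorem free_diff_alg_universal:
  fixes f :: "'i \<Rightarrow> 'b::comm_ring_1"
  assumes "differential_algebra sc d"
  shows "\<exists>!F. Vector_Spaces.linear cscale sc F \<and> F 1 = 1 \<and> (\<forall>p q. F (p * q) = F p * F q)
    \<and> (\<forall>p. F (dpartial p) = d (F p)) \<and> (\<forall>i. F (dvar 0 i) = f i)" (is "\<exists>!F. ?P F")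
proof -
  interpret R: differential_algebra sc d by fact
  interpret d: Vector_Spaces.linear sc sc d by (rule R.D_linear)
  define x where "x v = (d ^^ fst v) (f (snd v))" for v :: "nat \<times> 'i"
  define M where "M m = (\<Prod>v\<in>Poly_Mapping.keys m. x v ^ Poly_Mapping.lookup m v)" for m
  define F where "F p = (\<Sum>m\<in>Poly_Mapping.keys p. sc (Poly_Mapping.lookup p m) (M m))" for p
  have M_sup: "M m = (\<Prod>v\<in>S. x v ^ Poly_Mapping.lookup m v)"
    if "finite S" "Poly_Mapping.keys m \<subseteq> S" for m S
    unfolding M_def using that by (intro prod.mono_neutral_left) (auto simp: in_keys_iff)
  have M_add: "M (m + m') = M m * M m'" for m m'
  proof -
    have S: "finite (Poly_Mapping.keys m \<union> Poly_Mapping.keys m')" by simp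
    show ?thesis
      using keys_add[of m m'] M_sup[OF S, of m] M_sup[OF S, of m'] M_sup[OF S, of "m + m'"]
      by (simp add: lookup_add power_add prod.distrib)
  qed
  have M_single: "M (Poly_Mapping.single v 1) = x v" for v
    by (simp add: M_def)
  have M_0: "M 0 = 1" by (simp add: M_def)
  interpret F: Vector_Spaces.linear cscale sc F
    unfolding F_def [abs_def] by (rule linear_sum_keys) unfold_locales
  have F_single: "F (Poly_Mapping.single m c) = sc c (M m)" for m c
    by (simp add: F_def)
  have mult_right: "a * sc c b = sc c (a * b)" for a b c
    using R.scale_mult_left[of c b a] by (simp add: mult.commute)
  have F_1: "F 1 = 1"
    using F_single[of 0 1] by (simp add: M_0)
  have F_mult: "F (p * q) = F p * F q" for p q
  proof (induction p rule: poly_mapping_add_induct)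
    case (single m c)
    show ?case
      by (induction q rule: poly_mapping_add_induct)
        (simp_all add: F.add algebra_simps F_single mult_single M_add R.scale_mult_left mult_right)
  qed (simp_all add: F.add algebra_simps)
  have F_dvar: "F (dvar n i) = (d ^^ n) (f i)" for n i
    by (simp add: dvar_def F_single M_single[simplified] x_def)
  have d_1: "d 1 = 0"
    using R.D_mult[of 1 1] by simp
  have F_dmon: "F (dmon m) = d (M m)" for m
  proof (induction m rule: dmonom_induct)
    case zero
    then show ?case by (simp add: dmon_def M_0 d_1)
  next
    case (plus m v)
    have "dmon (Poly_Mapping.single v 1) = dvar (Suc (fst v)) (snd v)"
      by (cases v) (simp add: dmon_def dvar_def)
    then have "F (dmon (Poly_Mapping.single v 1)) = d (M (Poly_Mapping.single v 1))"
      by (simp only: F_dvar M_single x_def) simp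
    with plus show ?case
      unfolding dmon_add M_add R.D_mult F.add F_mult F_single by simp
  qed
  have F_D: "F (dpartial p) = d (F p)" for p
  proof -
    interpret D: Vector_Spaces.linear cscale cscale "dpartial :: 'i free_diff_alg \<Rightarrow> _"
      by (rule linear_dpartial)
    show ?thesis
      by (induction p rule: poly_mapping_add_induct)
        (simp_all add: D.add F.add d.add dpartial_single F_single F.scale d.scale F_dmon)
  qed
  show ?thesis
  proof (rule ex1I[of _ F])
    show "?P F"
      using F_1 F_mult F_D F_dvar[of 0] F.linear_axioms by simp
  next
    fix G assume G: "?P G"
    then interpret G: Vector_Spaces.linear cscale sc G by simp
    have G_dvar: "G (dvar n i) = (d ^^ n) (f i)" for n i
      using G by (induction n) (simp_all flip: dpartial_dvar)
    have G_mon: "G (Poly_Mapping.single m 1) = M m" for m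
    proof (induction m rule: dmonom_induct)
      case zero
      then show ?case using G by (simp add: M_0)
    next
      case (plus m v)
      have "Poly_Mapping.single (m + Poly_Mapping.single v 1) 1
          = (Poly_Mapping.single m 1 * dvar (fst v) (snd v) :: 'i free_diff_alg)"
        by (simp add: dvar_def mult_single)
      then show ?case
        using G plus by (simp only: M_add M_single x_def G_dvar)
    qed
    show "G = F"
    proof
      fix p
      show "G p = F p"
      proof (induction p rule: poly_mapping_add_induct)
        case (single m c)
        show ?case
          using G.scale[of c "Poly_Mapping.single m 1"] by (simp add: cscale_single G_mon F_single)
      qed (simp_all add: G.add F.add)
    qed
  qed
qed



section \<open>The Block type data\<close>

text \<open>
  Here \<open>V\<close> is \<open>nat \<Rightarrow>\<^sub>0 complex\<close>. \<open>block_coeff i n j\<close> is the coefficient of \<open>z\<close> to the power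
  \<open>-n-1\<close> of the prescribed value on \<open>(J\<^sub>i, J\<^sub>j)\<close>, and \<open>block_Y0\<close> is its bilinear extension.
\<close>

abbreviation J :: "nat \<Rightarrow> nat free_diff_alg" where
  "J \<equiv> dvar 0"

definition block_coeff :: "nat \<Rightarrow> nat \<Rightarrow> nat \<Rightarrow> nat free_diff_alg" where
  "block_coeff i n j =
    (if n = 0 then cscale (of_nat (i + 1)) (dpartial (J (i + j)))
     else if n = 1 then cscale (of_nat (i + j + 2)) (J (i + j))
     else 0)"

definition block_Y0 ::
    "(nat \<Rightarrow>\<^sub>0 complex) \<Rightarrow> nat \<Rightarrow> (nat \<Rightarrow>\<^sub>0 complex) \<Rightarrow> nat free_diff_alg" where
  "block_Y0 u n v = (\<Sum>i\<in>Poly_Mapping.keys u. \<Sum>j\<in>Poly_Mapping.keys v.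
      cscale (Poly_Mapping.lookup u i * Poly_Mapping.lookup v j) (block_coeff i n j))"

end

theory Submission
  imports Defs "HOL-Computational_Algebra.Polynomial"
begin

text \<open>
  Write the modes as a \<open>\<lambda>\<close>-bracket with values in \<open>A[\<lambda>]\<close>, the coefficient of \<open>\<lambda>\<^sup>n\<close> in the bracket of
  \<open>a\<close> and \<open>b\<close> being \<open>a\<^bsub>(n)\<^esub> b / n!\<close>. Then skew-symmetry says that the bracket of \<open>a\<close> and \<open>b\<close> arises
  from that of \<open>b\<close> and \<open>a\<close> by \<open>p(\<lambda>) \<mapsto> -p(-\<lambda>-\<partial>)\<close>. A bracket with \<open>a\<close> on the left is a derivation that
  intertwines \<open>\<partial>\<close> with \<open>\<partial> + \<lambda>\<close>, so it is determined by its values on the generators, which may be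
  prescribed freely. This determines the brackets of the \<open>J\<^sub>i\<close> with everything, by skew-symmetry the
  brackets of everything with the \<open>J\<^sub>i\<close>, and hence all brackets. Skew-symmetry of the result holds
  because \<open>f \<mapsto> skew [f, gh]\<close> is again such a derivation if skew-symmetry holds for \<open>g\<close> and \<open>h\<close>.
  The Jacobi identity is derivational in its last argument and symmetric in all three, so it only
  has to be checked on generators.
\<close>

section \<open>Polynomials over a differential algebra\<close>

lemma map_poly_add_hom:
  assumes "\<And>x y. f (x + y) = f x + f y"
  shows "map_poly f (p + q) = map_poly f p + map_poly (f :: 'a::ab_group_add \<Rightarrow> 'b::ab_group_add) q"
proof -
  have "f 0 = 0" using assms[of 0 0] by simp
  then show ?thesis by (intro poly_eqI) (simp add: coeff_map_poly assms)
qed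

context differential_algebra
begin

text \<open>Scalars are embedded in the algebra so that they can serve as evaluation points of
  polynomials and \<open>scale\<close> becomes ring multiplication.\<close>

definition konst :: "complex \<Rightarrow> 'a" where
  "konst c = scale c 1"

lemma scale_eq_konst: "scale c x = konst c * x"
  by (simp add: konst_def scale_mult_left)

lemma konst_add: "konst (c + d) = konst c + konst d"
  by (simp add: konst_def scale_left_distrib)

lemma konst_mult: "konst (c * d) = konst c * konst d"
  by (simp add: konst_def scale_mult_left)

lemma konst_0 [simp]: "konst 0 = 0" and konst_1 [simp]: "konst 1 = 1"
  by (simp_all add: konst_def)

lemma konst_minus: "konst (- c) = - konst c"
  by (simp add: konst_def)

lemma konst_diff: "konst (c - d) = konst c - konst d"
  by (simp add: konst_def scale_left_diff_distrib)

lemma konst_power: "konst (c ^ n) = konst c ^ n"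
  by (induction n) (simp_all add: konst_mult)

lemma konst_of_nat: "konst (of_nat n) = of_nat n"
  by (induction n) (simp_all add: konst_add)

lemma konst_inverse: "c \<noteq> 0 \<Longrightarrow> konst (inverse c) * (konst c * x) = x"
  by (simp flip: mult.assoc konst_mult)

lemma D_add: "D (x + y) = D x + D y"
  and D_scale: "D (scale c x) = scale c (D x)"
  and D_0 [simp]: "D 0 = 0"
  and D_minus: "D (- x) = - D x"
  and D_diff: "D (x - y) = D x - D y"
proof -
  interpret D: Vector_Spaces.linear scale scale D by (rule D_linear)
  show "D (x + y) = D x + D y" "D (scale c x) = scale c (D x)" "D 0 = 0" "D (- x) = - D x"
    "D (x - y) = D x - D y"
    by (rule D.add D.scale D.zero D.neg D.diff)+
qed

lemma D_1 [simp]: "D 1 = 0"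
  using D_mult[of 1 1] by simp

lemma D_konst [simp]: "D (konst c) = 0"
  by (simp add: konst_def D_scale)

text \<open>Thanks to this, the formal variable of a \<open>\<lambda>\<close>-bracket can be treated as a number.\<close>

lemma poly_zero_if_vanishes_on_infinite:
  assumes "infinite S" "\<And>c. c \<in> S \<Longrightarrow> poly p (konst c) = 0"
  shows "p = 0"
  using assms
proof (induction "degree p" arbitrary: p S rule: less_induct)
  case less
  obtain c where c: "c \<in> S" using less.prems(1) by (metis finite.emptyI ex_in_conv)
  then have "poly p (konst c) = 0" by (rule less.prems)
  then obtain q where q: "p = [:- konst c, 1:] * q" by (auto simp: poly_eq_0_iff_dvd elim: dvdE)
  show ?case
  proof (cases "q = 0")
    case False
    \<comment> \<open>The linear factor is monic, so the degree rises by exactly one even if the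
      algebra has zero divisors.\<close>
    have "degree p = Suc (degree q)"
    proof (rule order_antisym)
      show "degree p \<le> Suc (degree q)"
        unfolding q using degree_mult_le[of "[:- konst c, 1:]" q] by (simp add: le_trans)
      have "coeff p (Suc (degree q)) = coeff q (degree q)"
        unfolding q by (simp add: coeff_eq_0)
      then show "Suc (degree q) \<le> degree p"
        using False by (intro le_degree) simp
    qed
    moreover have "poly q (konst d) = 0" if "d \<in> S - {c}" for d
    proof -
      \<comment> \<open>This factor can be cancelled because nonzero scalars are units.\<close>
      have "konst (d - c) * poly q (konst d) = 0"
        using less.prems(2)[of d] that by (simp add: q konst_diff algebra_simps)
      then show ?thesis using konst_inverse[of "d - c" "poly q (konst d)"] that by simp
    qed
    ultimately have "q = 0"
      using less.hyps[of q "S - {c}"] less.prems(1) by simp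
    with False show ?thesis by simp
  qed (simp add: q)
qed

lemma poly_eqI_konst:
  assumes "\<And>c. poly p (konst c) = poly q (konst c)"
  shows "p = q"
  using poly_zero_if_vanishes_on_infinite[of UNIV "p - q"] assms
  by (simp add: infinite_UNIV_char_0)

lemma poly_map_poly_konst:
  assumes "\<And>x y. f (x + y) = f x + f y" "\<And>c x. f (konst c * x) = konst c * f x"
  shows "poly (map_poly f p) (konst c) = f (poly p (konst c))"
proof -
  have "f 0 = 0" using assms(1)[of 0 0] by simp
  then show ?thesis by (induction p) (simp_all add: map_poly_pCons assms)
qed

text \<open>The operators \<open>\<partial> + z\<close> and \<open>p(z) \<mapsto> -p(-z-\<partial>)\<close> on \<open>A[z]\<close>, the latter with \<open>\<partial>\<close> acting on the
  coefficients of \<open>p\<close>.\<close>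

definition E :: "'a poly \<Rightarrow> 'a poly" where
  "E p = map_poly D p + pCons 0 p"

definition skew :: "'a poly \<Rightarrow> 'a poly" where
  "skew p = fold_coeffs (\<lambda>a q. - [:a:] - E q) p 0"

lemma E_0 [simp]: "E 0 = 0"
  by (simp add: E_def)

lemma E_add: "E (p + q) = E p + E q"
  by (simp add: E_def map_poly_add_hom[of D, OF D_add] flip: add_pCons[of 0 p 0 q, simplified])

lemma E_minus: "E (- p) = - E p"
  using E_add[of p "- p"] by (simp add: add_eq_0_iff)

lemma E_diff: "E (p - q) = E p - E q"
  using E_add[of p "- q"] by (simp add: E_minus)

lemma E_pCons: "E (pCons a p) = pCons (D a) (E p + [:a:])"
  by (simp add: E_def map_poly_pCons)

lemma coeff_E: "coeff (E p) n = D (coeff p n) + (if n = 0 then 0 else coeff p (n - 1))"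
  by (cases n) (simp_all add: E_def coeff_map_poly)

lemma E_const_mult: "E ([:h:] * p) = [:D h:] * p + [:h:] * E p"
  by (intro poly_eqI) (auto simp: coeff_E D_mult algebra_simps)

lemma E_smult_konst: "E (smult (konst c) p) = smult (konst c) (E p)"
  using E_const_mult[of "konst c" p] by simp

lemma poly_E: "poly (E p) (konst c) = D (poly p (konst c)) + konst c * poly p (konst c)"
  by (induction p) (simp_all add: E_pCons D_add D_mult algebra_simps)

lemma skew_0 [simp]: "skew 0 = 0"
  by (simp add: skew_def)

text \<open>Horner's scheme: the substitution z \<rightarrow> -z-\<partial> turns a + z p into a -
  (\<partial>+z) p(-z-\<partial>), and the outer sign gives the formula.\<close>

lemma skew_pCons: "skew (pCons a p) = - [:a:] - E (skew p)"
  by (cases "p = 0"; cases "a = 0") (simp_all add: skew_def)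

lemma skew_add: "skew (p + q) = skew p + skew q"
  by (induction p q rule: poly_induct2) (simp_all add: skew_pCons E_add)

lemma skew_minus: "skew (- p) = - skew p"
  using skew_add[of p "- p"] by (simp add: add_eq_0_iff)

lemma skew_diff: "skew (p - q) = skew p - skew q"
  using skew_add[of p "- q"] by (simp add: skew_minus)

lemma skew_smult_konst: "skew (smult (konst c) p) = smult (konst c) (skew p)"
  by (induction p) (simp_all add: skew_pCons E_smult_konst smult_diff_right)

text \<open>The substitution z \<rightarrow> -z-\<partial> sends \<partial>+z to -z.\<close>

lemma skew_E: "skew (E p) = - pCons 0 (skew p)"
  by (induction p) (simp_all add: E_pCons skew_pCons skew_add E_add E_minus E_diff D_minus)

lemma skew_skew [simp]: "skew (skew p) = p"
  by (induction p) (simp_all add: skew_pCons skew_minus skew_diff skew_E)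

text \<open>
  The composite \<open>p \<mapsto> -skew (skew p * h)\<close> is \<open>p(z) \<mapsto> p(z+\<partial>) h\<close>, where \<open>\<partial>\<close> acts on \<open>h\<close> only.
\<close>

lemma skew_skew_mult_linear: "skew (skew ([:f:] * p) * [:h:]) = [:f:] * skew (skew p * [:h:])"
proof (induction p arbitrary: h)
  case (pCons a p)
  \<comment> \<open>The two signs of \<open>skew\<close> cancel, and (z+\<partial>) p(z+\<partial>)
    h splits into z p(z+\<partial>) h and p(z+\<partial>) \<partial>h. The second term is why the
    induction varies \<open>h\<close>.\<close>
  have *: "skew (skew (pCons a p) * [:h:])
      = [:a * h:] + pCons 0 (skew (skew p * [:h:])) + skew (skew p * [:D h:])" for a p h
  proof -
    have "E (skew p) * [:h:] = E (skew p * [:h:]) - skew p * [:D h:]"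
      using E_const_mult[of h "skew p"] by (simp add: mult.commute)
    then show ?thesis
      by (simp add: skew_pCons skew_diff skew_add skew_minus skew_E smult_diff_right mult.commute)
  qed
  show ?case
    using pCons(2)[of h] pCons(2)[of "D h"] *[of a p h] *[of "f * a" "[:f:] * p" h]
    by (simp add: algebra_simps smult_add_right)
qed simp

text \<open>Scalars commute with \<partial>: at z = c+d, the shifted argument (-z-\<partial>)+c is
  -d-\<partial>.\<close>

lemma poly_skew_pcompose:
  "poly (skew (pcompose p [:konst c, 1:])) (konst (c + d)) = poly (skew p) (konst d)"
  by (induction p)
    (simp_all add: pcompose_pCons skew_add skew_pCons skew_smult_konst poly_E
      poly_E[of _ "c + d", unfolded konst_add] konst_add algebra_simps)

text \<open>The binomial theorem for the commuting operators \<partial> and multiplication by z. For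
  n > k the binomial coefficient vanishes, so the truncated \<open>k - n\<close> is
  harmless.\<close>

lemma coeff_E_power_const: "coeff ((E ^^ k) [:a:]) n = of_nat (k choose n) * (D ^^ (k - n)) a"
proof (induction k arbitrary: n)
  case 0
  then show ?case by (cases n) simp_all
next
  case (Suc k)
  have D_of_nat: "D (of_nat j * x) = of_nat j * D x" for j x
    using D_konst[of "of_nat j"] by (simp add: D_mult konst_of_nat)
  show ?case
  proof (cases n)
    case (Suc m)
    show ?thesis
    proof (cases "k > m")
      case True
      then have "k - m = Suc (k - Suc m)" by simp
      then show ?thesis
        by (simp add: Suc.IH coeff_E D_of_nat \<open>n = Suc m\<close> algebra_simps)
    qed (simp add: Suc.IH coeff_E D_of_nat \<open>n = Suc m\<close> binomial_eq_0)
  qed (simp add: Suc.IH coeff_E D_of_nat)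
qed

lemma skew_monom: "skew (monom a k) = (- 1) ^ Suc k * (E ^^ k) [:a:]"
proof (induction k)
  case (Suc k)
  have "E ((- 1) ^ j * p) = (- 1) ^ j * E p" for j p
    by (induction j) (simp_all add: E_minus)
  then show ?case using Suc by (simp add: monom_Suc skew_pCons E_minus)
qed (simp add: monom_0 skew_pCons)

lemma coeff_skew:
  assumes "degree p \<le> N"
  shows "coeff (skew p) n
    = - (\<Sum>k\<le>N. (- 1) ^ k * of_nat (k choose n) * (D ^^ (k - n)) (coeff p k))"
proof -
  have sum: "skew (\<Sum>k\<in>K. f k) = (\<Sum>k\<in>K. skew (f k))" for K :: "nat set" and f
    by (induction K rule: infinite_finite_induct) (simp_all add: skew_add)
  have sgn: "coeff ((- 1) ^ k * q) n = (- 1) ^ k * coeff q n" for k and q :: "'a poly"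
    by (induction k) simp_all
  have "skew p = (\<Sum>k\<le>N. skew (monom (coeff p k) k))"
    using poly_as_sum_of_monoms'[OF assms] by (metis sum)
  then show ?thesis
    by (simp add: skew_monom coeff_sum sgn coeff_E_power_const sum_negf mult.assoc)
qed

text \<open>The behaviour of a bracket with its left argument fixed, isolated so that existence and
  uniqueness can be settled for one left argument at a time.\<close>

definition lambda_derivation :: "('a \<Rightarrow> 'a poly) \<Rightarrow> bool" where
  "lambda_derivation d \<longleftrightarrow> (\<forall>x y. d (x + y) = d x + d y) \<and> (\<forall>c x. d (scale c x) = smult (konst c) (d x))
    \<and> (\<forall>x y. d (x * y) = [:y:] * d x + [:x:] * d y) \<and> (\<forall>x. d (D x) = E (d x))"

lemma lambda_derivationD:
  assumes "lambda_derivation d"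
  shows "d (x + y) = d x + d y" "d (scale c x) = smult (konst c) (d x)"
    "d (x * y) = [:y:] * d x + [:x:] * d y" "d (D x) = E (d x)"
  using assms by (simp_all add: lambda_derivation_def)

end


section \<open>Lambda brackets\<close>

text \<open>The n-th derivative divided by n!, written without division.\<close>

definition hasse_deriv :: "nat \<Rightarrow> 'a::comm_ring_1 poly \<Rightarrow> 'a poly" where
  "hasse_deriv n p = (\<Sum>k\<le>degree p. monom (of_nat (k choose n) * coeff p k) (k - n))"

lemma coeff_hasse_deriv: "coeff (hasse_deriv n p) j = of_nat ((n + j) choose n) * coeff p (n + j)"
proof -
  have "coeff (hasse_deriv n p) j
      = (\<Sum>k\<le>degree p. if k = n + j then of_nat (k choose n) * coeff p k else 0)"
    unfolding hasse_deriv_def coeff_sum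
    by (intro sum.cong refl) (auto simp: binomial_eq_0 not_le)
  also have "\<dots> = of_nat ((n + j) choose n) * coeff p (n + j)"
    by (simp add: coeff_eq_0)
  finally show ?thesis .
qed

text \<open>Taylor's formula for p(z+c).\<close>

lemma poly_hasse_deriv: "poly (hasse_deriv n p) c = coeff (pcompose p [:c, 1:]) n"
proof -
  have "pcompose p [:c, 1:] = (\<Sum>k\<le>degree p. smult (coeff p k) ([:c, 1:] ^ k))"
    by (simp add: pcompose_altdef poly_altdef degree_map_poly coeff_map_poly)
  moreover have "coeff ([:c, 1:] ^ k) n = of_nat (k choose n) * c ^ (k - n)" for k
    by (cases "n \<le> k")
      (simp_all add: coeff_linear_poly_power binomial_eq_0 coeff_eq_0 degree_linear_power)
  ultimately show ?thesis
    by (simp add: hasse_deriv_def poly_sum poly_monom coeff_sum mult_ac)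
qed

text \<open>Rules are imposed on the right argument only; \<open>skew\<close> transports them to the
  left one. The Jacobi identity is kept apart, to be derived from generators.\<close>

locale lambda_bracket = differential_algebra scale D
  for scale :: "complex \<Rightarrow> 'a::comm_ring_1 \<Rightarrow> 'a" and D :: "'a \<Rightarrow> 'a" +
  fixes B :: "'a \<Rightarrow> 'a \<Rightarrow> 'a poly"
  assumes right_derivation: "lambda_derivation (B a)"
    and skew_symmetry: "B a b = skew (B b a)"
begin

lemmas B_right = lambda_derivationD[OF right_derivation]

lemma B_add_left: "B (a + b) c = B a c + B b c"
  using skew_symmetry B_right(1) skew_add by metis

lemma B_scale_left: "B (scale s a) c = smult (konst s) (B a c)"
  using skew_symmetry B_right(2) skew_smult_konst by metis

lemma B_D_left: "B (D a) c = - pCons 0 (B a c)"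
  using skew_symmetry B_right(4) skew_E by metis

text \<open>Evaluating the formal variable at a complex number turns identities in two variables
  into identities in the algebra; \<open>poly_eqI_konst\<close> leads back to polynomials.\<close>

definition br :: "'a \<Rightarrow> complex \<Rightarrow> 'a \<Rightarrow> 'a" where
  "br a s b = poly (B a b) (konst s)"

lemma br_add_left: "br (a + b) s c = br a s c + br b s c"
  and br_konst_left: "br (konst t * a) s c = konst t * br a s c"
  and br_D_left: "br (D a) s c = - (konst s * br a s c)"
  and br_add: "br a s (b + c) = br a s b + br a s c"
  and br_konst: "br a s (konst t * b) = konst t * br a s b"
  and br_mult: "br a s (b * c) = br a s b * c + b * br a s c"
  and br_D: "br a s (D b) = D (br a s b) + konst s * br a s b"
  using B_scale_left[of t a c] B_right(2)[of a t b]
  by (simp_all add: br_def B_add_left B_D_left B_right poly_E scale_eq_konst mult.commute)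

lemma br_0_left [simp]: "br 0 s c = 0" and br_0 [simp]: "br a s 0 = 0"
  using br_add_left[of 0 0] br_add[of a s 0 0] by simp_all

lemma br_minus_left: "br (- a) s c = - br a s c"
  using br_add_left[of a "- a"] by (simp add: add_eq_0_iff)

lemma br_minus: "br a s (- b) = - br a s b"
  using br_add[of a s b "- b"] by (simp add: add_eq_0_iff)

lemma br_diff_left: "br (a - b) s c = br a s c - br b s c"
  using br_add_left[of a "- b"] by (simp add: br_minus_left)

lemma br_diff: "br a s (b - c) = br a s b - br a s c"
  using br_add[of a s b "- c"] by (simp add: br_minus)

section \<open>The Jacobi identity and its symmetries\<close>

definition jacobi :: "'a \<Rightarrow> 'a \<Rightarrow> 'a \<Rightarrow> bool" where
  "jacobi a b c \<longleftrightarrow> (\<forall>s t. br a s (br b t c) - br b t (br a s c) = br (br a s b) (s + t) c)"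

lemma jacobi_polynomial:
  assumes "jacobi a b c"
  shows "map_poly (br a s) (B b c) - B b (br a s c) = pcompose (B (br a s b) c) [:konst s, 1:]"
proof (rule poly_eqI_konst)
  fix t
  show "poly (map_poly (br a s) (B b c) - B b (br a s c)) (konst t)
      = poly (pcompose (B (br a s b) c) [:konst s, 1:]) (konst t)"
    using assms poly_map_poly_konst[of "br a s" "B b c" t, OF br_add br_konst]
    by (simp add: poly_pcompose jacobi_def br_def konst_add)
qed

text \<open>Since \<open>br a s\<close> carries \<partial> to \<partial>+s, it turns the substituted
  value -t-\<partial> into -(s+t)-\<partial>.\<close>

lemma br_poly_skew:
  "br a s (poly (skew p) (konst t)) = poly (skew (map_poly (br a s) p)) (konst (s + t))"
proof (induction p)
  case (pCons x p)
  then show ?case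
    by (simp add: map_poly_pCons skew_pCons br_diff br_minus br_add br_konst br_D poly_E konst_add
        poly_E[of _ "s + t", unfolded konst_add] algebra_simps)
qed simp

text \<open>Exchanging \<open>b\<close> and \<open>c\<close> amounts to the substitution \<open>t \<mapsto> -s-t-\<partial>\<close>.\<close>

lemma jacobi_swap_right:
  assumes "jacobi a c b"
  shows "jacobi a b c"
  unfolding jacobi_def
proof (intro allI)
  fix s t
  \<comment> \<open>All three terms become values at s+t of polynomials under \<open>skew\<close>,
    so that the polynomial form of the hypothesis can be applied inside.\<close>
  have "br a s (br b t c) = poly (skew (map_poly (br a s) (B c b))) (konst (s + t))"
    unfolding br_poly_skew[symmetric] skew_symmetry[of c b] br_def[of b] by simp
  moreover have "br (br a s b) (s + t) c = poly (skew (B c (br a s b))) (konst (s + t))"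
    unfolding br_def[of "br a s b"] skew_symmetry[of "br a s b" c] ..
  moreover have "br b t (br a s c)
      = poly (skew (pcompose (B (br a s c) b) [:konst s, 1:])) (konst (s + t))"
    unfolding poly_skew_pcompose br_def[of b] skew_symmetry[of b "br a s c"] ..
  ultimately show "br a s (br b t c) - br b t (br a s c) = br (br a s b) (s + t) c"
    unfolding jacobi_polynomial[OF assms, symmetric] by (simp add: skew_diff)
qed

text \<open>In the left argument of a bracket at s+t, \<partial> acts as -(s+t), so -s-\<partial>
  acts as t.\<close>

lemma br_skew_left: "br (poly (skew p) (konst s)) (s + t) c = - br (poly p (konst t)) (s + t) c"
  by (induction p)
    (simp_all add: skew_pCons poly_E br_diff_left br_minus_left br_add_left br_D_left br_konst_left
      konst_add algebra_simps)

text \<open>Exchanging a with b and s with t negates the commutator, and by skew-symmetry also the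
  right-hand side.\<close>

lemma jacobi_swap_left:
  assumes "jacobi b a c"
  shows "jacobi a b c"
  unfolding jacobi_def
proof (intro allI)
  fix s t
  have "br (br a s b) (s + t) c = - br (br b t a) (t + s) c"
    unfolding br_def[of a s b] skew_symmetry[of a b] br_skew_left
    by (simp add: br_def[of b t a] add.commute)
  also have "\<dots> = - (br b t (br a s c) - br a s (br b t c))"
    using assms by (simp add: jacobi_def)
  finally show "br a s (br b t c) - br b t (br a s c) = br (br a s b) (s + t) c"
    by simp
qed

lemma jacobi_add: "jacobi a b c \<Longrightarrow> jacobi a b d \<Longrightarrow> jacobi a b (c + d)"
  by (simp add: jacobi_def br_add algebra_simps)

lemma jacobi_scale: "jacobi a b c \<Longrightarrow> jacobi a b (scale u c)"
  by (simp add: jacobi_def scale_eq_konst br_konst flip: right_diff_distrib)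

text \<open>The commutator of two derivations is a derivation, as the mixed terms cancel.\<close>

lemma jacobi_mult:
  assumes "jacobi a b c" "jacobi a b d"
  shows "jacobi a b (c * d)"
  unfolding jacobi_def
proof (intro allI)
  fix s t
  have "br a s (br b t (c * d)) - br b t (br a s (c * d))
      = (br a s (br b t c) - br b t (br a s c)) * d + c * (br a s (br b t d) - br b t (br a s d))"
    by (simp add: br_mult br_add algebra_simps)
  then show "br a s (br b t (c * d)) - br b t (br a s (c * d)) = br (br a s b) (s + t) (c * d)"
    using assms by (simp add: jacobi_def br_mult)
qed

lemma jacobi_D:
  assumes "jacobi a b c"
  shows "jacobi a b (D c)"
  unfolding jacobi_def
proof (intro allI)
  fix s t
  have "br a s (br b t (D c)) - br b t (br a s (D c))
      = D (br a s (br b t c) - br b t (br a s c))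
        + konst (s + t) * (br a s (br b t c) - br b t (br a s c))"
    by (simp add: br_add br_D br_konst D_diff konst_add algebra_simps)
  then show "br a s (br b t (D c)) - br b t (br a s (D c)) = br (br a s b) (s + t) (D c)"
    using assms by (simp add: jacobi_def br_D)
qed

lemma jacobi_one: "jacobi a b 1"
  using br_mult[of _ _ 1 1] by (simp add: jacobi_def)

text \<open>The coefficient of \<lambda>^m \<mu>^n in the Jacobi identity, where s and t take the
  place of \<lambda> and \<mu>. On the right, Taylor's formula extracts the power of \<mu> from the
  bracket at \<lambda>+\<mu>.\<close>

lemma jacobi_coeff:
  assumes "jacobi a b c"
  shows "coeff (B a (coeff (B b c) n)) m - coeff (B b (coeff (B a c) m)) n
    = (\<Sum>i\<le>m. of_nat ((m + n - i) choose n) * coeff (B (coeff (B a b) i) c) (m + n - i))"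
proof -
  define f where "f x = coeff (B b x) n" for x
  \<comment> \<open>The bound must cover all of \<open>B a b\<close> and also every index up to m,
    which the final sum ranges over.\<close>
  define N where "N = max m (degree (B a b))"
  define Q where "Q = (\<Sum>i\<le>N. monom 1 i * hasse_deriv n (B (coeff (B a b) i) c))"
  have f: "f (x + y) = f x + f y" "f (konst s * x) = konst s * f x" for x y s
    using B_right(2)[of b s x] by (simp_all add: f_def B_right scale_eq_konst)
  have f0: "f 0 = 0" using f(1)[of 0 0] by simp
  have "B a (coeff (B b c) n) - map_poly f (B a c) = Q"
  proof (rule poly_eqI_konst)
    fix s
    define g where "g x = coeff (pcompose (B x c) [:konst s, 1:]) n" for x
    have g: "g (x + y) = g x + g y" "g (konst s * x) = konst s * g x" for x y s
      using B_scale_left[of s x c]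
      by (simp_all add: g_def B_add_left pcompose_add pcompose_smult scale_eq_konst)
    have g_sum: "g (\<Sum>i\<in>I. h i) = (\<Sum>i\<in>I. g (h i))" for I :: "nat set" and h
      using g(1)[of 0 0] by (induction I rule: infinite_finite_induct) (simp_all add: g(1))
    have "br a s b = (\<Sum>i\<le>N. konst (s ^ i) * coeff (B a b) i)"
    proof -
      have "br a s b = (\<Sum>i\<le>degree (B a b). konst (s ^ i) * coeff (B a b) i)"
        by (simp add: br_def poly_altdef konst_power mult.commute)
      also have "\<dots> = (\<Sum>i\<le>N. konst (s ^ i) * coeff (B a b) i)"
        by (intro sum.mono_neutral_left) (auto simp: N_def coeff_eq_0)
      finally show ?thesis .
    qed
    then have "g (br a s b) = (\<Sum>i\<le>N. konst (s ^ i) * g (coeff (B a b) i))"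
      by (simp add: g_sum g(2))
    then have "poly Q (konst s) = g (br a s b)"
      by (simp add: Q_def poly_sum poly_monom poly_hasse_deriv g_def konst_power)
    also have "\<dots> = coeff (map_poly (br a s) (B b c) - B b (br a s c)) n"
      by (simp add: g_def jacobi_polynomial[OF assms])
    also have "\<dots> = br a s (coeff (B b c) n) - f (br a s c)"
      by (simp add: coeff_map_poly f_def)
    also have "\<dots> = poly (B a (coeff (B b c) n) - map_poly f (B a c)) (konst s)"
      by (simp add: poly_map_poly_konst f br_def)
    finally show "poly (B a (coeff (B b c) n) - map_poly f (B a c)) (konst s) = poly Q (konst s)"
      by simp
  qed
  then have "coeff (B a (coeff (B b c) n) - map_poly f (B a c)) m = coeff Q m"
    by (rule arg_cong)
  then have "coeff (B a (coeff (B b c) n)) m - f (coeff (B a c) m) = coeff Q m"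
    by (simp add: coeff_map_poly f0)
  also have "\<dots> = (\<Sum>i\<le>N. if i \<le> m then coeff (hasse_deriv n (B (coeff (B a b) i) c)) (m - i) else 0)"
    unfolding Q_def coeff_sum by (intro sum.cong refl) (simp add: coeff_monom_mult)
  also have "\<dots> = (\<Sum>i\<le>m. coeff (hasse_deriv n (B (coeff (B a b) i) c)) (m - i))"
    by (intro sum.mono_neutral_cong_right) (auto simp: N_def)
  also have "\<dots> = (\<Sum>i\<le>m. of_nat ((m + n - i) choose n) * coeff (B (coeff (B a b) i) c) (m + n - i))"
    by (intro sum.cong refl) (simp add: coeff_hasse_deriv add.commute)
  finally show ?thesis by (simp add: f_def)
qed

section \<open>From brackets to modes\<close>

definition modes :: "'a \<Rightarrow> nat \<Rightarrow> 'a \<Rightarrow> 'a" where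
  "modes a n b = scale (fact n) (coeff (B a b) n)"

text \<open>This is \<open>coeff_skew\<close> with k = n+i, by (n+i)!/i! = n! ((n+i) choose n). The
  indices k < n contribute nothing because their binomial coefficients vanish.\<close>

lemma modes_half_skew:
  "modes a n b = - Sum_any (\<lambda>i. scale ((- 1) ^ (n + i) / fact i) ((D ^^ i) (modes b (n + i) a)))"
proof -
  define N where "N = degree (B b a)"
  have D_pow: "(D ^^ i) (scale s x) = scale s ((D ^^ i) x)" for i s x
    by (induction i) (simp_all add: D_scale)
  have D_pow_0: "(D ^^ i) 0 = 0" for i
    by (induction i) simp_all
  have "Sum_any (\<lambda>i. scale ((- 1) ^ (n + i) / fact i) ((D ^^ i) (modes b (n + i) a)))
      = (\<Sum>i\<le>N. scale ((- 1) ^ (n + i) / fact i) ((D ^^ i) (modes b (n + i) a)))"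
    by (intro Sum_any.expand_superset)
      (auto simp: modes_def N_def D_pow_0 coeff_eq_0 not_le intro!: leI)
  also have "\<dots> = (\<Sum>i\<le>N. scale (fact n) ((- 1) ^ (n + i) * of_nat ((n + i) choose n)
      * (D ^^ i) (coeff (B b a) (n + i))))"
  proof (intro sum.cong refl)
    fix i
    have "fact (n + i) = fact n * (fact i * of_nat ((n + i) choose n) :: complex)"
      using arg_cong[OF binomial_fact_lemma[of n "n + i"], of "of_nat :: nat \<Rightarrow> complex"]
      by (simp add: mult.assoc)
    then have fact:  "(- 1) ^ (n + i) / fact i * fact (n + i)
        = (fact n * ((- 1) ^ (n + i) * of_nat ((n + i) choose n)) :: complex)"
      by simp
    have sgn: "(- 1) ^ (n + i) * of_nat ((n + i) choose n) * x
        = scale ((- 1) ^ (n + i) * of_nat ((n + i) choose n)) x" for x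
      by (simp add: scale_eq_konst konst_mult konst_power konst_minus konst_of_nat)
    show "scale ((- 1) ^ (n + i) / fact i) ((D ^^ i) (modes b (n + i) a))
      = scale (fact n) ((- 1) ^ (n + i) * of_nat ((n + i) choose n) * (D ^^ i) (coeff (B b a) (n + i)))"
      unfolding modes_def D_pow scale_scale sgn fact ..
  qed
  also have "\<dots> = scale (fact n) (\<Sum>k\<in>{n..n + N}. (- 1) ^ k * of_nat (k choose n)
      * (D ^^ (k - n)) (coeff (B b a) k))"
    unfolding scale_sum_right
    by (rule sum.reindex_bij_witness[of _ "\<lambda>k. k - n" "\<lambda>i. n + i"]) auto
  also have "\<dots> = scale (fact n) (\<Sum>k\<le>n + N. (- 1) ^ k * of_nat (k choose n)
      * (D ^^ (k - n)) (coeff (B b a) k))"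
    by (intro arg_cong[where f = "scale _"] sum.mono_neutral_left) (auto simp: binomial_eq_0)
  also have "\<dots> = - scale (fact n) (coeff (skew (B b a)) n)"
    by (subst coeff_skew[of _ "n + N"]) (auto simp: N_def)
  finally show ?thesis
    using skew_symmetry[of a b] by (simp add: modes_def)
qed

text \<open>The factorials in \<open>modes\<close> convert \<open>jacobi_coeff\<close> through (m
  choose i) i! (m+n-i)! = m! n! ((m+n-i) choose n).\<close>

lemma modes_half_commutator:
  assumes "jacobi a b c"
  shows "modes a m (modes b n c) - modes b n (modes a m c)
    = (\<Sum>i\<le>m. scale (of_nat (m choose i)) (modes (modes a i b) (m + n - i) c))"
proof -
  have mm: "modes a m (modes b n c) = konst (fact m * fact n) * coeff (B a (coeff (B b c) n)) m"
    for a b m n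
    by (simp add: modes_def B_right(2) konst_mult mult.assoc) (simp add: scale_eq_konst)
  have "konst (of_nat (m choose i) * (fact i * fact (m + n - i)))
      = konst (fact m * fact n * of_nat ((m + n - i) choose n))" if "i \<le> m" for i
  proof -
    have "fact i * fact (m - i) * (m choose i) = fact m"
      using that by (rule binomial_fact_lemma)
    moreover have "fact n * fact (m - i) * ((m + n - i) choose n) = fact (m + n - i)"
      using binomial_fact_lemma[of n "m + n - i"] that by simp
    ultimately have "(m choose i) * (fact i * fact (m + n - i)) = fact m * fact n * ((m + n - i) choose n)"
      by (simp add: mult_ac flip: \<open>_ = fact m\<close> \<open>_ = fact (m + n - i)\<close>)
    from arg_cong[OF this, of "of_nat :: nat \<Rightarrow> complex"] show ?thesis
      by simp
  qed
  moreover have "modes (modes a i b) k c = konst (fact i * fact k) * coeff (B (coeff (B a b) i) c) k"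
    for i k
    by (simp add: modes_def B_scale_left konst_mult) (simp add: scale_eq_konst mult_ac)
  ultimately have "(\<Sum>i\<le>m. scale (of_nat (m choose i)) (modes (modes a i b) (m + n - i) c))
    = konst (fact m * fact n) * (\<Sum>i\<le>m. of_nat ((m + n - i) choose n)
        * coeff (B (coeff (B a b) i) c) (m + n - i))"
    unfolding sum_distrib_left
    by (intro sum.cong refl) (simp add: scale_eq_konst flip: konst_of_nat konst_mult mult.assoc)
  then show ?thesis
    unfolding jacobi_coeff[OF assms, symmetric] mm
    by (simp add: algebra_simps)
qed

lemma vertex_Poisson_algebra_modes:
  assumes "\<And>a b c. jacobi a b c"
  shows "vertex_Poisson_algebra scale modes D"
proof unfold_locales
  fix a b c :: 'a and m n :: nat and r :: complex
  show "modes (a + b) n c = modes a n c + modes b n c"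
    "modes a n (b + c) = modes a n b + modes a n c"
    by (simp_all add: modes_def B_add_left B_right scale_right_distrib)
  show "modes (scale r a) n b = scale r (modes a n b)"
    "modes a n (scale r b) = scale r (modes a n b)"
    unfolding modes_def B_scale_left B_right by (simp_all add: scale_eq_konst mult_ac)
  show "\<exists>N. \<forall>n\<ge>N. modes a n b = 0"
    by (intro exI[of _ "Suc (degree (B a b))"]) (auto simp: modes_def coeff_eq_0)
  show "modes (D a) n b = - scale (of_nat n) (modes a (n - 1) b)"
    by (cases n) (simp_all add: modes_def B_D_left)
  show "modes a n (D b) = D (modes a n b) + scale (of_nat n) (modes a (n - 1) b)"
    by (cases n) (simp_all add: modes_def B_right coeff_E D_scale scale_right_distrib)
  show "modes a n b = - Sum_any (\<lambda>i. scale ((- 1) ^ (n + i) / fact i) ((D ^^ i) (modes b (n + i) a)))"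
    by (rule modes_half_skew)
  show "modes a m (modes b n c) - modes b n (modes a m c)
    = (\<Sum>i\<le>m. scale (of_nat (m choose i)) (modes (modes a i b) (m + n - i) c))"
    by (rule modes_half_commutator) (rule assms)
  show "modes a n (b * c) = modes a n b * c + b * modes a n c"
    unfolding modes_def B_right(3) by (simp add: scale_eq_konst distrib_left mult_ac)
qed (rule D_add D_scale)+

end


section \<open>Brackets on the free differential algebra\<close>

text \<open>Dual numbers: homomorphisms into them are pairs of a homomorphism and a derivation.\<close>

datatype 'a dual = Dual (std: 'a) (eps: 'a)

instantiation dual :: (comm_ring_1) comm_ring_1
begin

definition "0 = Dual 0 0"
definition "1 = Dual 1 0"
definition "x + y = Dual (std x + std y) (eps x + eps y)"
definition "x - y = Dual (std x - std y) (eps x - eps y)"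
definition "- x = Dual (- std x) (- eps x)"
definition "x * y = Dual (std x * std y) (eps x * std y + std x * eps y)"

instance
  by standard (simp_all add: zero_dual_def one_dual_def plus_dual_def minus_dual_def uminus_dual_def
      times_dual_def dual.expand algebra_simps)

end

lemma dual_simps [simp]:
  "std 0 = 0" "eps 0 = 0" "std 1 = 1" "eps 1 = 0"
  "std (x + y) = std x + std y" "eps (x + y) = eps x + eps y"
  "std (x * y) = std x * std y" "eps (x * y) = eps x * std y + std x * eps y"
  by (simp_all add: zero_dual_def one_dual_def plus_dual_def times_dual_def)

context differential_algebra
begin

lemma map_poly_D_mult: "map_poly D (p * q) = map_poly D p * q + p * map_poly D q"
proof (induction p)
  case (pCons a p)
  have "map_poly D (smult a q) = smult (D a) q + smult a (map_poly D q)"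
    by (intro poly_eqI) (simp add: coeff_map_poly D_mult)
  with pCons show ?case
    by (simp add: map_poly_add_hom[of D, OF D_add] map_poly_pCons algebra_simps)
qed simp

lemma map_poly_D_smult_konst: "map_poly D (smult (konst c) p) = smult (konst c) (map_poly D p)"
  by (intro poly_eqI) (simp add: coeff_map_poly D_mult)

lemma E_mult: "E (p * q) = E p * q + p * map_poly D q"
  by (simp add: E_def map_poly_D_mult algebra_simps)

text \<open>The standard part carries \<partial> and the infinitesimal part \<partial>+z. By
  \<open>E_mult\<close> this obeys the Leibniz rule, so homomorphisms into it encode the
  intertwining with \<open>E\<close>.\<close>

lemma differential_algebra_dual:
  "differential_algebra (\<lambda>c x. Dual (smult (konst c) (std x)) (smult (konst c) (eps x)))
    (\<lambda>x. Dual (map_poly D (std x)) (E (eps x)))"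
  by unfold_locales
    (simp_all add: dual.expand konst_add konst_mult smult_add_left smult_add_right E_add E_mult
      map_poly_add_hom[of D, OF D_add] map_poly_D_mult E_smult_konst map_poly_D_smult_konst
      algebra_simps)

end

section \<open>Derivations determined by their values on generators\<close>

lemma free_diff_alg_induct [case_names one add scale mult D gen]:
  assumes one: "P 1"
    and add: "\<And>p q. P p \<Longrightarrow> P q \<Longrightarrow> P (p + q)"
    and scale: "\<And>c p. P p \<Longrightarrow> P (cscale c p)"
    and mult: "\<And>p q. P p \<Longrightarrow> P q \<Longrightarrow> P (p * q)"
    and D: "\<And>p. P p \<Longrightarrow> P (dpartial p)"
    and gen: "\<And>i. P (dvar 0 i)"
  shows "P (p :: 'i free_diff_alg)"
proof -
  have P_dvar: "P (dvar n i)" for n i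
    by (induction n) (auto intro: gen D simp flip: dpartial_dvar)
  have mon: "P (Poly_Mapping.single m 1)" for m
  proof (induction m rule: dmonom_induct)
    case (plus m v)
    have "Poly_Mapping.single (m + Poly_Mapping.single v 1) 1
        = (Poly_Mapping.single m 1 * dvar (fst v) (snd v) :: 'i free_diff_alg)"
      by (simp add: dvar_def mult_single)
    with mult[OF plus P_dvar] show ?case by metis
  qed (simp add: one)
  have single: "P (Poly_Mapping.single m c)" for m c
    using scale[OF mon, of c m] by (simp add: cscale_single)
  show ?thesis
    by (induction p rule: poly_mapping_add_induct) (use single[of 0 0] in \<open>simp_all add: single add\<close>)
qed

interpretation free: differential_algebra cscale dpartial
  by (rule differential_algebra_free)

lemma lambda_derivation_unique:
  assumes d: "free.lambda_derivation d" and e: "free.lambda_derivation e"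
    and gen: "\<And>i. d (dvar 0 i) = e (dvar 0 i)"
  shows "d = e"
proof
  fix p
  have "d 1 = 0" if "free.lambda_derivation d" for d :: "'a free_diff_alg \<Rightarrow> _"
    using free.lambda_derivationD(3)[OF that, of 1 1] by simp
  from this[OF d] this[OF e] show "d p = e p"
    using gen free.lambda_derivationD[OF d] free.lambda_derivationD[OF e]
    by (induction p rule: free_diff_alg_induct) simp_all
qed

text \<open>The universal property is applied to the dual numbers over A[z], each generator
  receiving its prescribed value as infinitesimal part. The standard part is then the inclusion of A
  as constants, and the infinitesimal part is the required derivation.\<close>

lemma lambda_derivation_exists:
  fixes w :: "'i \<Rightarrow> 'i free_diff_alg poly"
  shows "\<exists>d. free.lambda_derivation d \<and> (\<forall>i. d (dvar 0 i) = w i)"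
proof -
  let ?sc = "\<lambda>c x. Dual (smult (free.konst c) (std x)) (smult (free.konst c) (eps x))"
  let ?d = "\<lambda>x. Dual (map_poly dpartial (std x)) (free.E (eps x))"
  obtain F :: "'i free_diff_alg \<Rightarrow> 'i free_diff_alg poly dual"
    where F: "Vector_Spaces.linear cscale ?sc F" "F 1 = 1" "\<And>p q. F (p * q) = F p * F q"
      "\<And>p. F (dpartial p) = ?d (F p)" "\<And>i. F (dvar 0 i) = Dual [:dvar 0 i:] (w i)"
    using free_diff_alg_universal[OF free.differential_algebra_dual, of "\<lambda>i. Dual [:dvar 0 i:] (w i)"]
    by auto
  interpret F: Vector_Spaces.linear cscale ?sc F by (rule F)
  have std: "std (F p) = [:p:]" for p
  proof (induction p rule: free_diff_alg_induct)
    case (scale c p)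
    then show ?case by (simp add: F.scale flip: free.scale_eq_konst)
  qed (simp_all add: F F.add map_poly_pCons one_pCons)
  have "free.lambda_derivation (eps \<circ> F)"
    by (simp add: free.lambda_derivation_def F.add F.scale F(3,4) std mult.commute)
  then show ?thesis using F(5) by (intro exI[of _ "eps \<circ> F"]) simp
qed

lemma lambda_derivation_add:
  assumes "free.lambda_derivation d" "free.lambda_derivation e"
  shows "free.lambda_derivation (\<lambda>p. d p + e p)"
  using assms unfolding free.lambda_derivation_def
  by (simp add: free.E_add algebra_simps smult_add_right)

theorem free_lambda_bracket_exists:
  fixes w :: "'i \<Rightarrow> 'i \<Rightarrow> 'i free_diff_alg poly"
  assumes w: "\<And>i j. w i j = free.skew (w j i)"
  shows "\<exists>B. lambda_bracket cscale dpartial B \<and> (\<forall>i j. B (dvar 0 i) (dvar 0 j) = w i j)"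
proof -
  have "\<exists>B0. \<forall>i. free.lambda_derivation (B0 i) \<and> (\<forall>j. B0 i (dvar 0 j) = w i j)"
    by (intro choice allI lambda_derivation_exists)
  then obtain B0 where B0: "\<And>i. free.lambda_derivation (B0 i)" "\<And>i j. B0 i (dvar 0 j) = w i j"
    by blast
  \<comment> \<open>Second extension: skew-symmetry forces the values on a generator in the right
    argument.\<close>
  have "\<exists>B. \<forall>f. free.lambda_derivation (B f) \<and> (\<forall>j. B f (dvar 0 j) = free.skew (B0 j f))"
    by (intro choice allI lambda_derivation_exists)
  then obtain B where B: "\<And>f. free.lambda_derivation (B f)"
    and B_gen: "\<And>f j. B f (dvar 0 j) = free.skew (B0 j f)"
    by blast
  note B_right = free.lambda_derivationD[OF B]
  have B_eq: "B f = d"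
    if "free.lambda_derivation d" "\<And>j. d (dvar 0 j) = free.skew (B0 j f)" for f d
    by (rule lambda_derivation_unique) (simp_all add: B B_gen that)
  \<comment> \<open>The two extensions agree here because \<open>w\<close> is skew-symmetric on
    generators.\<close>
  have B_dvar: "B (dvar 0 i) = B0 i" for i
    by (rule B_eq) (simp_all add: B0 flip: w)
  have B_add: "B (f + g) = (\<lambda>p. B f p + B g p)" for f g
    by (rule B_eq)
      (simp_all add: lambda_derivation_add B B_gen free.lambda_derivationD[OF B0(1)] free.skew_add)
  have B_scale: "B (cscale c f) = (\<lambda>p. smult (free.konst c) (B f p))" for c f
  proof (rule B_eq)
    show "free.lambda_derivation (\<lambda>p. smult (free.konst c) (B f p))"
      using B[of f] unfolding free.lambda_derivation_def
      by (simp add: smult_add_right free.E_smult_konst mult.commute)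
  qed (simp add: B_gen free.lambda_derivationD[OF B0(1)] free.skew_smult_konst)
  have B_D: "B (dpartial f) = (\<lambda>p. - pCons 0 (B f p))" for f
  proof (rule B_eq)
    show "free.lambda_derivation (\<lambda>p. - pCons 0 (B f p))"
      using B[of f] unfolding free.lambda_derivation_def
      by (simp add: smult_add_right free.E_minus free.E_pCons)
  qed (simp add: B_gen free.lambda_derivationD[OF B0(1)] free.skew_E)
  have B_one: "B f 1 = 0" for f
    using B_right(3)[of f 1 1] by simp
  have "B g f = free.skew (B f g)" for f g
  proof (induction g arbitrary: f rule: free_diff_alg_induct)
    case one
    have "B 1 = (\<lambda>p. 0)"
    proof (rule B_eq)
      show "free.lambda_derivation (\<lambda>p. 0)"
        by (simp add: free.lambda_derivation_def)
      show "0 = free.skew (B0 j 1)" for j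
        using B_one[of "dvar 0 j"] by (simp add: B_dvar)
    qed
    then show ?case by (simp add: B_one)
  next
    case (add g h)
    then show ?case by (simp add: B_add B_right free.skew_add)
  next
    case (scale c g)
    then show ?case by (simp add: B_scale B_right free.skew_smult_konst)
  next
    case (D g)
    then show ?case by (simp add: B_D B_right free.skew_E)
  next
    case (gen i)
    then show ?case by (simp add: B_dvar B_gen)
  next
    case (mult g h)
    have eq: "free.skew (B f (g * h))
        = free.skew (free.skew (B g f) * [:h:]) + free.skew (free.skew (B h f) * [:g:])" for f
      by (simp add: mult.IH B_right free.skew_add mult.commute)
    \<comment> \<open>Both sides are derivations in f with the same values on generators. On the
      right this holds because, in \<open>eq\<close>, \<open>B g\<close> and \<open>B h\<close> are
      derivations and \<open>skew_skew_mult_linear\<close> lets coefficients pass through.\<close>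
    have "B (g * h) = (\<lambda>f. free.skew (B f (g * h)))"
    proof (rule B_eq)
      have "free.skew (B (a * b) (g * h))
          = [:b:] * free.skew (B a (g * h)) + [:a:] * free.skew (B b (g * h))" for a b
        unfolding eq unfolding B_right(3) free.skew_add distrib_right free.skew_skew_mult_linear
        by (simp only: algebra_simps)
      moreover have "free.skew (B (dpartial a) (g * h)) = free.E (free.skew (B a (g * h)))" for a
        by (simp add: B_D free.skew_minus free.skew_pCons free.E_minus)
      ultimately show "free.lambda_derivation (\<lambda>f. free.skew (B f (g * h)))"
        unfolding free.lambda_derivation_def
        by (simp add: B_add B_scale free.skew_add free.skew_smult_konst)
    qed (simp add: B_dvar)
    then show ?case by (rule fun_cong)
  qed
  then have "lambda_bracket cscale dpartial B"
    by (intro lambda_bracket.intro lambda_bracket_axioms.intro differential_algebra_free B)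
  moreover have "B (dvar 0 i) (dvar 0 j) = w i j" for i j
    by (simp add: B_dvar B0)
  ultimately show ?thesis by blast
qed

text \<open>Only the third argument can be extended directly; the swaps bring each of the other
  arguments into that place in turn.\<close>

lemma jacobi_from_generators:
  fixes B :: "'i free_diff_alg \<Rightarrow> 'i free_diff_alg \<Rightarrow> 'i free_diff_alg poly"
  assumes "lambda_bracket cscale dpartial B"
    and gen: "\<And>i j k. lambda_bracket.jacobi cscale B (dvar 0 i) (dvar 0 j) (dvar 0 k)"
  shows "lambda_bracket.jacobi cscale B a b c"
proof -
  interpret lambda_bracket cscale dpartial B by fact
  have extend: "jacobi a b c" if "\<And>i. jacobi a b (dvar 0 i)" for a b c
    by (induction c rule: free_diff_alg_induct)
      (simp_all add: that jacobi_one jacobi_add jacobi_scale jacobi_mult jacobi_D)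
  have 1: "jacobi (dvar 0 i) (dvar 0 j) c" for i j c
    by (rule extend) (rule gen)
  have 2: "jacobi (dvar 0 i) b c" for i b c
    by (rule extend) (rule jacobi_swap_right[OF 1])
  show ?thesis
    by (rule extend) (rule jacobi_swap_right, rule jacobi_swap_left, rule 2)
qed

text \<open>The derivation rules extend agreement in the right argument, half skew-symmetry moves
  the generator from left to right, and a second extension reaches all pairs.\<close>

lemma free_vertex_Poisson_unique:
  assumes "vertex_Poisson_algebra cscale Y dpartial" and "vertex_Poisson_algebra cscale Z dpartial"
    and gen: "\<And>i j n. Y (dvar 0 i) n (dvar 0 j) = Z (dvar 0 i) n (dvar 0 j)"
  shows "Y = Z"
proof -
  interpret Y: vertex_Poisson_algebra cscale Y dpartial by fact
  interpret Z: vertex_Poisson_algebra cscale Z dpartial by fact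
  interpret Y_right: Vector_Spaces.linear cscale cscale "\<lambda>b. Y a n b" for a n
    by (rule Y.Y_linear_right)
  interpret Z_right: Vector_Spaces.linear cscale cscale "\<lambda>b. Z a n b" for a n
    by (rule Z.Y_linear_right)
  have extend: "Y a n b = Z a n b" if "\<And>i n. Y a n (dvar 0 i) = Z a n (dvar 0 i)" for a n b
  proof (induction b arbitrary: n rule: free_diff_alg_induct)
    case one
    show ?case using Y.Y_mult_right[of a n 1 1] Z.Y_mult_right[of a n 1 1] by simp
  next
    case (add p q)
    then show ?case by (simp add: Y_right.add Z_right.add)
  next
    case (scale c p)
    then show ?case by (simp add: Y_right.scale Z_right.scale)
  qed (simp_all add: that Y.Y_mult_right Z.Y_mult_right Y.Y_D_right Z.Y_D_right)
  have "Y (dvar 0 i) n b = Z (dvar 0 i) n b" for i n b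
    by (rule extend) (rule gen)
  then have gen_right: "Y a n (dvar 0 i) = Z a n (dvar 0 i)" for a n i
    unfolding Y.half_skew_symmetry[of a n "dvar 0 i"] Z.half_skew_symmetry[of a n "dvar 0 i"] by simp
  show ?thesis
    by (intro ext, rule extend) (rule gen_right)
qed

section \<open>The Block type structure\<close>

lemma block_Y0_single: "block_Y0 (Poly_Mapping.single i 1) n (Poly_Mapping.single j 1) = block_coeff i n j"
  by (simp add: block_Y0_def cscale_def)

lemma incl_single: "incl (Poly_Mapping.single i 1) = dvar 0 i"
  by (simp add: incl_def cscale_def)

theorem proposition5p4:
  shows "\<exists>!Y :: nat free_diff_alg \<Rightarrow> nat \<Rightarrow> nat free_diff_alg \<Rightarrow> nat free_diff_alg.
    vertex_Poisson_algebra cscale Y dpartial \<and>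
    (\<forall>u v n. Y (incl u) n (incl v) = block_Y0 u n v)"
proof -
  \<comment> \<open>The prescribed modes as a polynomial; the factorials 0! and 1! are both
    1.\<close>
  define w where "w i j = [:of_nat (i + 1) * dvar 1 (i + j), of_nat (i + j + 2) * J (i + j):]" for i j
  have D_of_nat: "dpartial (of_nat k * p) = of_nat k * dpartial p" for k and p :: "nat free_diff_alg"
  proof -
    have "dpartial (of_nat k :: nat free_diff_alg) = 0" by (simp flip: free.konst_of_nat)
    then show ?thesis by (simp add: free.D_mult)
  qed
  have "free.skew [:p, q:] = [:dpartial q - p, q:]" for p q :: "nat free_diff_alg"
    by (simp add: free.skew_pCons free.E_minus free.E_pCons free.D_minus)
  \<comment> \<open>The constant terms match because (i+j+2) - (j+1) = i+1.\<close>
  then have "w i j = free.skew (w j i)" for i j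
    by (simp only: w_def D_of_nat dpartial_dvar) (simp add: algebra_simps)
  then obtain B where B: "lambda_bracket cscale dpartial B" and B_gen: "\<And>i j. B (J i) (J j) = w i j"
    using free_lambda_bracket_exists[of w] by blast
  interpret lambda_bracket cscale dpartial B by fact
  have br_of_nat: "br a s (of_nat k * b) = of_nat k * br a s b"
    "br (of_nat k * a) s b = of_nat k * br a s b" for a b s k
    using br_konst[of a s "of_nat k"] br_konst_left[of "of_nat k"] by (simp_all add: free.konst_of_nat)
  have D_konst_mult: "dpartial (free.konst s * p) = free.konst s * dpartial p"
    for s and p :: "nat free_diff_alg"
    by (simp add: free.D_mult)
  have br_gen: "br (J i) s (J j)
      = of_nat (i + 1) * dpartial (J (i + j)) + free.konst s * (of_nat (i + j + 2) * J (i + j))"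
    for i j s
    by (simp add: br_def B_gen w_def dpartial_dvar)
  have "jacobi (J i) (J j) (J k)" for i j k
    unfolding jacobi_def
  proof (intro allI)
    fix s t
    show "br (J i) s (br (J j) t (J k)) - br (J j) t (br (J i) s (J k))
        = br (br (J i) s (J j)) (s + t) (J k)"
      \<comment> \<open>Every nested bracket reduces to a combination of
        \<open>J (i + j + k)\<close> and its first two derivatives, so only a polynomial identity in
        i, j, k, s, t remains.\<close>
      unfolding br_gen br_add br_add_left br_konst br_konst_left br_of_nat br_D br_D_left
        free.D_add D_konst_mult D_of_nat free.konst_add
      by (simp add: add.assoc add.left_commute algebra_simps)
  qed
  then have "jacobi a b c" for a b c
    by (rule jacobi_from_generators[OF B])
  then have V: "vertex_Poisson_algebra cscale modes dpartial"
    by (rule vertex_Poisson_algebra_modes)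
  have modes_gen: "modes (J i) n (J j) = block_coeff i n j" for i j n
  proof -
    consider "n = 0" | "n = 1" | k where "n = Suc (Suc k)"
      by (metis One_nat_def nat.exhaust)
    then show ?thesis
      by cases (simp_all add: modes_def B_gen w_def block_coeff_def dpartial_dvar free.scale_eq_konst
          free.konst_of_nat of_nat_1[unfolded One_nat_def] del: of_nat_add of_nat_Suc)
  qed
  interpret V: vertex_Poisson_algebra cscale modes dpartial by (rule V)
  show ?thesis
  proof (rule ex1I[of _ modes])
    have "modes (incl u) n (incl v) = block_Y0 u n v" for u v n
    proof -
      interpret L: Vector_Spaces.linear cscale cscale "\<lambda>a. modes a n b" for b
        by (rule V.Y_linear_left)
      interpret R: Vector_Spaces.linear cscale cscale "\<lambda>b. modes a n b" for a
        by (rule V.Y_linear_right)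
      show ?thesis
        unfolding incl_def L.sum L.scale
        unfolding R.sum R.scale modes_gen block_Y0_def free.scale_sum_right free.scale_scale ..
    qed
    with V show "vertex_Poisson_algebra cscale modes dpartial \<and>
        (\<forall>u v n. modes (incl u) n (incl v) = block_Y0 u n v)" by simp
  next
    fix Y
    assume Y: "vertex_Poisson_algebra cscale Y dpartial \<and>
        (\<forall>u v n. Y (incl u) n (incl v) = block_Y0 u n v)"
    show "Y = modes"
    proof (rule free_vertex_Poisson_unique)
      fix i j n
      have "Y (incl (Poly_Mapping.single i 1)) n (incl (Poly_Mapping.single j 1))
          = block_Y0 (Poly_Mapping.single i 1) n (Poly_Mapping.single j 1)"
        using Y by simp
      then show "Y (J i) n (J j) = modes (J i) n (J j)"
        unfolding incl_single block_Y0_single modes_gen .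
    qed (use Y V in blast)+
  qed
qed

end
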